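(* Let $\Sigma$ be a set. The Kleisli category $\mathcal{K}l(\mathfrak{D}(\Sigma^\ast\times\mathcal{I}d+\Sigma^\omega))$ described in the context, with the given hom-set ordering, satisfies the following: (A) it is order enriched with a pointwise induced order; (B) it is $\omega\mathsf{Cpo}$-enriched; (C) it is left distributive; (D) its hom-sets are complete lattices.
   Context: For a set $X$ let $\mathfrak{D}X=(X\to[0,1])\to_\omega[0,1]$, where $X\to[0,1]$ is ordered pointwise and $P\to_\omega Q$ is the set of functions from $P$ to $Q$ preserving suprema of (ascending) $\omega$-chains. The category $\mathcal{K}l(\mathfrak{D}(\Sigma^\ast\times\mathcal{I}d+\Sigma^\omega))$: objects are sets; morphisms $f\colon X\rightharpoonup Y$ are maps $f\colon X\to\mathfrak{D}(\Sigma^\ast\times Y+\Sigma^\omega)$, where $\Sigma^\ast$ and $\Sigma^\omega$ are the sets of finite and infinite words over $\Sigma$. Identities are $\mathsf{id}(x)(d)=d(\varepsilon,x)$. For $f\colon X\rightharpoonup Y$ and $g\colon Y\rightharpoonup Z$ and $d\colon\Sigma^\ast\times Z+\Sigma^\omega\to[0,1]$, $$(g\cdot f)(x)(d)=f(x)\big((\sigma,y)\mapsto g(y)(d_{|\sigma}),\ v\mapsto d(v)\big),$$ where $d_{|\sigma}(\tau,z)=d(\sigma\tau,z)$ and $d_{|\sigma}(v)=d(\sigma v)$ for $\tau\in\Sigma^\ast$, $z\in Z$, $v\in\Sigma^\omega$. Ordering: $f\le g$ iff $f(x)(d)\le g(x)(d)$ for all $x\in X$ and all $d\colon\Sigma^\ast\times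 Y+\Sigma^\omega\to[0,1]$. Terminology for a Kleisli category $\mathcal{K}l(M)$ of a $\mathsf{Set}$-monad $M$. Order enriched: hom-sets are posets and composition is monotone. Pointwise induced: each $MY$ is a poset and $f\le g$ iff $f(x)\le g(x)$ for all $x$. $\omega\mathsf{Cpo}$-enriched: every countable ascending chain of morphisms with common domain and codomain has a supremum, preserved by composition on both sides. Left distributive: all finite (possibly empty) suprema exist in hom-posets and $g\cdot\bigvee_{i\in I}f_i=\bigvee_{i\in I}g\cdot f_i$ for every finite $I$. *)

theory Defs
  imports Complex_Main "HOL-Library.FuncSet" "HOL-Library.Stream" "HOL-Algebra.Complete_Lattice"
begin

text \<open>
  Sets are rendered as carrier sets, so that the empty set and an empty alphabet are included,
  and maps between them as extensional functions, so that equality of maps is equality in HOL.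
  The objects of a Kleisli category are the sets over an arbitrary type \<open>'a\<close>.
\<close>

section \<open>Omega-continuous maps\<close>

definition omega_chain :: "('a, 'm) gorder_scheme \<Rightarrow> (nat \<Rightarrow> 'a) \<Rightarrow> bool" where
  "omega_chain P c \<longleftrightarrow> (\<forall>n. c n \<in> carrier P) \<and> (\<forall>n. c n \<sqsubseteq>\<^bsub>P\<^esub> c (Suc n))"

definition pointwise_order :: "'a set \<Rightarrow> ('b, 'm) gorder_scheme \<Rightarrow> ('a \<Rightarrow> 'b) gorder" where
  "pointwise_order A Q =
     \<lparr>carrier = A \<rightarrow>\<^sub>E carrier Q, eq = (=), le = (\<lambda>f g. \<forall>x\<in>A. f x \<sqsubseteq>\<^bsub>Q\<^esub> g x)\<rparr>"

definition omega_continuous ::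
  "('a, 'm) gorder_scheme \<Rightarrow> ('b, 'n) gorder_scheme \<Rightarrow> ('a \<Rightarrow> 'b) \<Rightarrow> bool" where
  "omega_continuous P Q F \<longleftrightarrow>
     (\<forall>c u. omega_chain P c \<and> is_lub P u (range c) \<longrightarrow> is_lub Q (F u) (range (\<lambda>n. F (c n))))"

definition omega_maps ::
  "('a, 'm) gorder_scheme \<Rightarrow> ('b, 'n) gorder_scheme \<Rightarrow> ('a \<Rightarrow> 'b) gorder" where
  "omega_maps P Q =
     \<lparr>carrier = {F \<in> carrier P \<rightarrow>\<^sub>E carrier Q. omega_continuous P Q F},
      eq = (=),
      le = (\<lambda>F G. \<forall>d\<in>carrier P. F d \<sqsubseteq>\<^bsub>Q\<^esub> G d)\<rparr>"

definition unit_interval :: "real gorder" where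
  "unit_interval = \<lparr>carrier = {0..1}, eq = (=), le = (\<le>)\<rparr>"

definition DD :: "'x set \<Rightarrow> (('x \<Rightarrow> real) \<Rightarrow> real) gorder" where
  "DD X = omega_maps (pointwise_order X unit_interval) unit_interval"


section \<open>Kleisli categories of monads on sets\<close>

text \<open>
  A monad \<open>M\<close> is given as a Kleisli triple: \<open>Mon C Y\<close> is \<open>M Y\<close> together with its order,
  \<open>ext C Y Z g\<close> is the extension \<open>M Y \<rightarrow> M Z\<close> of \<open>g : Y \<rightarrow> M Z\<close>, and \<open>hle C X Y\<close> is the
  ordering of the morphisms from \<open>X\<close> to \<open>Y\<close>.
\<close>

record ('a, 'm) kleisli =
  Mon :: "'a set \<Rightarrow> 'm gorder"
  ident :: "'a set \<Rightarrow> 'a \<Rightarrow> 'm"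
  ext :: "'a set \<Rightarrow> 'a set \<Rightarrow> ('a \<Rightarrow> 'm) \<Rightarrow> 'm \<Rightarrow> 'm"
  hle :: "'a set \<Rightarrow> 'a set \<Rightarrow> ('a \<Rightarrow> 'm) \<Rightarrow> ('a \<Rightarrow> 'm) \<Rightarrow> bool"

definition khom :: "('a, 'm) kleisli \<Rightarrow> 'a set \<Rightarrow> 'a set \<Rightarrow> ('a \<Rightarrow> 'm) gorder" where
  "khom C X Y = \<lparr>carrier = X \<rightarrow>\<^sub>E carrier (Mon C Y), eq = (=), le = hle C X Y\<rparr>"

definition kcomp ::
  "('a, 'm) kleisli \<Rightarrow> 'a set \<Rightarrow> 'a set \<Rightarrow> 'a set \<Rightarrow> ('a \<Rightarrow> 'm) \<Rightarrow> ('a \<Rightarrow> 'm) \<Rightarrow> 'a \<Rightarrow> 'm" where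
  "kcomp C X Y Z g f = (\<lambda>x\<in>X. ext C Y Z g (f x))"

definition kleisli_category :: "('a, 'm) kleisli \<Rightarrow> bool" where
  "kleisli_category C \<longleftrightarrow>
     (\<forall>X. ident C X \<in> carrier (khom C X X)) \<and>
     (\<forall>X Y Z. \<forall>f\<in>carrier (khom C X Y). \<forall>g\<in>carrier (khom C Y Z).
        kcomp C X Y Z g f \<in> carrier (khom C X Z)) \<and>
     (\<forall>X Y. \<forall>f\<in>carrier (khom C X Y).
        kcomp C X X Y f (ident C X) = f \<and> kcomp C X Y Y (ident C Y) f = f) \<and>
     (\<forall>W X Y Z. \<forall>f\<in>carrier (khom C W X). \<forall>g\<in>carrier (khom C X Y). \<forall>h\<in>carrier (khom C Y Z).
        kcomp C W X Z (kcomp C X Y Z h g) f = kcomp C W Y Z h (kcomp C W X Y g f))"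

definition order_enriched :: "('a, 'm) kleisli \<Rightarrow> bool" where
  "order_enriched C \<longleftrightarrow>
     kleisli_category C \<and>
     (\<forall>X Y. partial_order (khom C X Y)) \<and>
     (\<forall>X Y Z. \<forall>f\<in>carrier (khom C X Y). \<forall>f'\<in>carrier (khom C X Y).
              \<forall>g\<in>carrier (khom C Y Z). \<forall>g'\<in>carrier (khom C Y Z).
        f \<sqsubseteq>\<^bsub>khom C X Y\<^esub> f' \<and> g \<sqsubseteq>\<^bsub>khom C Y Z\<^esub> g' \<longrightarrow>
        kcomp C X Y Z g f \<sqsubseteq>\<^bsub>khom C X Z\<^esub> kcomp C X Y Z g' f')"

definition pointwise_induced :: "('a, 'm) kleisli \<Rightarrow> bool" where
  "pointwise_induced C \<longleftrightarrow>
     (\<forall>Y. partial_order (Mon C Y)) \<and>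
     (\<forall>X Y. \<forall>f\<in>carrier (khom C X Y). \<forall>g\<in>carrier (khom C X Y).
        f \<sqsubseteq>\<^bsub>khom C X Y\<^esub> g \<longleftrightarrow> (\<forall>x\<in>X. f x \<sqsubseteq>\<^bsub>Mon C Y\<^esub> g x))"

definition omega_Cpo_enriched :: "('a, 'm) kleisli \<Rightarrow> bool" where
  "omega_Cpo_enriched C \<longleftrightarrow>
     order_enriched C \<and>
     (\<forall>X Y c. omega_chain (khom C X Y) c \<longrightarrow> (\<exists>u. is_lub (khom C X Y) u (range c))) \<and>
     (\<forall>X Y Z c u. \<forall>g\<in>carrier (khom C Y Z).
        omega_chain (khom C X Y) c \<and> is_lub (khom C X Y) u (range c) \<longrightarrow>
        is_lub (khom C X Z) (kcomp C X Y Z g u) (range (\<lambda>n. kcomp C X Y Z g (c n)))) \<and>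
     (\<forall>X Y Z c u. \<forall>f\<in>carrier (khom C X Y).
        omega_chain (khom C Y Z) c \<and> is_lub (khom C Y Z) u (range c) \<longrightarrow>
        is_lub (khom C X Z) (kcomp C X Y Z u f) (range (\<lambda>n. kcomp C X Y Z (c n) f)))"

definition left_distributive :: "('a, 'm) kleisli \<Rightarrow> bool" where
  "left_distributive C \<longleftrightarrow>
     (\<forall>X Y F. finite F \<and> F \<subseteq> carrier (khom C X Y) \<longrightarrow> (\<exists>u. is_lub (khom C X Y) u F)) \<and>
     (\<forall>X Y Z F u. \<forall>g\<in>carrier (khom C Y Z).
        finite F \<and> F \<subseteq> carrier (khom C X Y) \<and> is_lub (khom C X Y) u F \<longrightarrow>
        is_lub (khom C X Z) (kcomp C X Y Z g u) (kcomp C X Y Z g ` F))"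


section \<open>The Kleisli category of words and omega-continuous functionals\<close>

definition words :: "'s set \<Rightarrow> 'a set \<Rightarrow> ('s list \<times> 'a + 's stream) set" where
  "words \<Sigma> Y = (lists \<Sigma> \<times> Y) <+> streams \<Sigma>"

definition observations ::
  "'s set \<Rightarrow> 'a set \<Rightarrow> ('s list \<times> 'a + 's stream \<Rightarrow> real) set" where
  "observations \<Sigma> Y = words \<Sigma> Y \<rightarrow>\<^sub>E {0..1}"

text \<open>The observation \<open>d\<^bsub>|\<sigma>\<^esub>\<close>.\<close>
definition residual ::
  "'s set \<Rightarrow> 'a set \<Rightarrow> ('s list \<times> 'a + 's stream \<Rightarrow> real) \<Rightarrow> 's list \<Rightarrow>
   ('s list \<times> 'a + 's stream \<Rightarrow> real)" where
  "residual \<Sigma> Z d \<sigma> =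
     (\<lambda>w\<in>words \<Sigma> Z. case w of Inl (\<tau>, z) \<Rightarrow> d (Inl (\<sigma> @ \<tau>, z)) | Inr v \<Rightarrow> d (Inr (\<sigma> @- v)))"

type_synonym ('s, 'a) functional = "('s list \<times> 'a + 's stream \<Rightarrow> real) \<Rightarrow> real"

definition DW_ident :: "'s set \<Rightarrow> 'a set \<Rightarrow> 'a \<Rightarrow> ('s, 'a) functional" where
  "DW_ident \<Sigma> X = (\<lambda>x\<in>X. \<lambda>d\<in>observations \<Sigma> X. d (Inl ([], x)))"

definition DW_ext ::
  "'s set \<Rightarrow> 'a set \<Rightarrow> 'a set \<Rightarrow> ('a \<Rightarrow> ('s, 'a) functional) \<Rightarrow>
   ('s, 'a) functional \<Rightarrow> ('s, 'a) functional" where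
  "DW_ext \<Sigma> Y Z g F =
     (\<lambda>d\<in>observations \<Sigma> Z.
        F (\<lambda>w\<in>words \<Sigma> Y. case w of Inl (\<sigma>, y) \<Rightarrow> g y (residual \<Sigma> Z d \<sigma>) | Inr v \<Rightarrow> d (Inr v)))"

definition DW_le ::
  "'s set \<Rightarrow> 'a set \<Rightarrow> 'a set \<Rightarrow>
   ('a \<Rightarrow> ('s, 'a) functional) \<Rightarrow> ('a \<Rightarrow> ('s, 'a) functional) \<Rightarrow> bool" where
  "DW_le \<Sigma> X Y f g \<longleftrightarrow> (\<forall>x\<in>X. \<forall>d\<in>observations \<Sigma> Y. f x d \<le> g x d)"

definition KlDW :: "'s set \<Rightarrow> ('a, ('s, 'a) functional) kleisli" where
  "KlDW \<Sigma> =
     \<lparr>Mon = (\<lambda>Y. DD (words \<Sigma> Y)),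
      ident = DW_ident \<Sigma>,
      ext = DW_ext \<Sigma>,
      hle = DW_le \<Sigma>\<rparr>"

end

theory Submission
  imports Defs
begin

text \<open>
  Every subset of the unit interval has a supremum, and suprema commute with suprema; hence
  pointwise suprema of omega-continuous maps are omega-continuous, and all suprema of morphisms
  are computed pointwise. The composite \<open>g \<cdot> f\<close> is \<open>f x\<close> evaluated at the observation
  \<open>plug g d\<close>. Suprema in \<open>f\<close> are therefore preserved trivially, whereas chains in \<open>g\<close> (and in
  the observation \<open>d\<close>) give chains of plugged observations, which \<open>f x\<close> preserves by
  omega-continuity.
\<close>

section \<open>Pointwise suprema\<close>

text \<open>\<open>Upper\<close> tests only those elements of \<open>S\<close> that lie in the
  carrier; for \<open>S\<close> inside the carrier this restriction vanishes.\<close>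

lemma is_lub_iff:
  assumes "S \<subseteq> carrier L"
  shows "is_lub L u S \<longleftrightarrow> u \<in> carrier L \<and> (\<forall>x\<in>S. x \<sqsubseteq>\<^bsub>L\<^esub> u) \<and>
           (\<forall>y\<in>carrier L. (\<forall>x\<in>S. x \<sqsubseteq>\<^bsub>L\<^esub> y) \<longrightarrow> u \<sqsubseteq>\<^bsub>L\<^esub> y)"
  using assms unfolding least_def Upper_def by blast

lemma partial_orderI:
  assumes "eq L = (=)"
    and "\<And>x. x \<in> carrier L \<Longrightarrow> x \<sqsubseteq>\<^bsub>L\<^esub> x"
    and "\<And>x y. \<lbrakk>x \<sqsubseteq>\<^bsub>L\<^esub> y; y \<sqsubseteq>\<^bsub>L\<^esub> x; x \<in> carrier L; y \<in> carrier L\<rbrakk> \<Longrightarrow> x = y"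
    and "\<And>x y z. \<lbrakk>x \<sqsubseteq>\<^bsub>L\<^esub> y; y \<sqsubseteq>\<^bsub>L\<^esub> z; x \<in> carrier L; y \<in> carrier L; z \<in> carrier L\<rbrakk>
            \<Longrightarrow> x \<sqsubseteq>\<^bsub>L\<^esub> z"
  shows "partial_order L"
  by unfold_locales (use assms(2-4) in \<open>auto simp: assms(1)\<close>)

text \<open>An infimum of \<open>S\<close> is obtained as the supremum of its lower bounds, so
  suprema of all subsets suffice.\<close>

lemma complete_lattice_lubI:
  fixes L (structure)
  assumes "partial_order L"
    and lub: "\<And>S. S \<subseteq> carrier L \<Longrightarrow> \<exists>u. is_lub L u S"
  shows "complete_lattice L"
proof -
  interpret partial_order L by fact
  have "\<exists>i. greatest L i (Lower L S)" if S: "S \<subseteq> carrier L" for S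
  proof -
    obtain u where "is_lub L u (Lower L S)"
      using lub[OF Lower_closed] by blast
    then have u: "u \<in> carrier L" "\<forall>x\<in>Lower L S. x \<sqsubseteq> u"
      "\<forall>y\<in>carrier L. (\<forall>x\<in>Lower L S. x \<sqsubseteq> y) \<longrightarrow> u \<sqsubseteq> y"
      by (simp_all add: is_lub_iff)
    \<comment> \<open>Every element of \<open>S\<close> is an upper bound of
      \<open>Lower L S\<close>, hence lies above the least such bound \<open>u\<close>.\<close>
    have "u \<in> Lower L S"
      using u S unfolding Lower_def by blast
    then show ?thesis
      using u by (auto simp: greatest_def)
  qed
  then show ?thesis
    by unfold_locales (use lub in auto)
qed

text \<open>The common pattern behind observations, functionals and hom-sets.
  \<open>carrier L\<close> may be a proper part of the function space, so that omega-continuous maps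
  are covered; \<open>L\<close> is again a complete lattice, so the construction can be
  iterated.\<close>

locale function_lattice = Q: complete_lattice Q
  for Q :: "('b, 'm) gorder_scheme" (structure)
    and A :: "'a set" and L :: "('a \<Rightarrow> 'b) gorder" +
  assumes carrier_L: "carrier L \<subseteq> A \<rightarrow>\<^sub>E carrier Q"
    and eq_L: "eq L = (=)"
    and le_L: "\<And>f g. f \<sqsubseteq>\<^bsub>L\<^esub> g \<longleftrightarrow> (\<forall>x\<in>A. f x \<sqsubseteq> g x)"
    and sup_L: "\<And>S. S \<subseteq> carrier L \<Longrightarrow> (\<lambda>x\<in>A. \<Squnion>((\<lambda>f. f x) ` S)) \<in> carrier L"
begin

lemma value_closed: "f \<in> carrier L \<Longrightarrow> x \<in> A \<Longrightarrow> f x \<in> carrier Q"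
  using carrier_L by (auto dest: subsetD)

lemma values_closed: "S \<subseteq> carrier L \<Longrightarrow> x \<in> A \<Longrightarrow> (\<lambda>f. f x) ` S \<subseteq> carrier Q"
  using value_closed by blast

lemma partial_order: "partial_order L"
proof (rule partial_orderI)
  show "f = g" if "f \<sqsubseteq>\<^bsub>L\<^esub> g" "g \<sqsubseteq>\<^bsub>L\<^esub> f" "f \<in> carrier L" "g \<in> carrier L" for f g
  proof (rule PiE_ext)
    show "f \<in> A \<rightarrow>\<^sub>E carrier Q" "g \<in> A \<rightarrow>\<^sub>E carrier Q"
      using that carrier_L by auto
    show "f x = g x" if "x \<in> A" for x
      using that \<open>f \<sqsubseteq>\<^bsub>L\<^esub> g\<close> \<open>g \<sqsubseteq>\<^bsub>L\<^esub> f\<close> \<open>f \<in> carrier L\<close> \<open>g \<in> carrier L\<close>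
      by (auto simp: le_L intro!: Q.le_antisym value_closed)
  qed
  show "f \<sqsubseteq>\<^bsub>L\<^esub> h"
    if "f \<sqsubseteq>\<^bsub>L\<^esub> g" "g \<sqsubseteq>\<^bsub>L\<^esub> h" "f \<in> carrier L" "g \<in> carrier L" "h \<in> carrier L" for f g h
    using that by (auto simp: le_L intro: Q.le_trans value_closed)
qed (auto simp: eq_L le_L value_closed)

lemma is_lub_sup:
  assumes "S \<subseteq> carrier L"
  shows "is_lub L (\<lambda>x\<in>A. \<Squnion>((\<lambda>f. f x) ` S)) S"
proof -
  have "f x \<sqsubseteq> \<Squnion>((\<lambda>f. f x) ` S)" if "f \<in> S" "x \<in> A" for f x
    using Q.sup_upper[OF values_closed[OF assms]] that by blast
  moreover have "\<Squnion>((\<lambda>f. f x) ` S) \<sqsubseteq> g x"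
    if "g \<in> carrier L" "\<forall>f\<in>S. \<forall>x\<in>A. f x \<sqsubseteq> g x" "x \<in> A" for g x
    using that by (intro Q.sup_least values_closed[OF assms]) (auto intro: value_closed)
  ultimately show ?thesis
    using sup_L assms by (auto simp: is_lub_iff le_L)
qed

lemma complete_lattice: "complete_lattice L"
  using complete_lattice_lubI[OF partial_order] is_lub_sup by blast

text \<open>Suprema are unique in \<open>L\<close> and in \<open>Q\<close>, so any supremum is the
  pointwise one; outside \<open>A\<close> the maps agree by extensionality.\<close>

lemma is_lub_pointwise:
  assumes "S \<subseteq> carrier L"
  shows "is_lub L u S \<longleftrightarrow> u \<in> carrier L \<and> (\<forall>x\<in>A. is_lub Q (u x) ((\<lambda>f. f x) ` S))"
proof (intro iffI conjI ballI)
  assume u: "is_lub L u S"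
  then have "u = (\<lambda>x\<in>A. \<Squnion>((\<lambda>f. f x) ` S))"
    using partial_order.least_unique[OF partial_order] is_lub_sup[OF assms] by blast
  then show "is_lub Q (u x) ((\<lambda>f. f x) ` S)" if "x \<in> A" for x
    using Q.sup_lub[OF values_closed[OF assms that]] that by simp
  show "u \<in> carrier L"
    using u by blast
next
  assume u: "u \<in> carrier L \<and> (\<forall>x\<in>A. is_lub Q (u x) ((\<lambda>f. f x) ` S))"
  have "u x = \<Squnion>((\<lambda>f. f x) ` S)" if "x \<in> A" for x
    using u that Q.least_unique Q.sup_lub[OF values_closed[OF assms that]] by blast
  then have "u = (\<lambda>x\<in>A. \<Squnion>((\<lambda>f. f x) ` S))"
    using u carrier_L by (intro ext) (auto simp: PiE_def extensional_def restrict_def)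
  then show "is_lub L u S"
    using is_lub_sup[OF assms] by simp
qed

end

section \<open>Lattices of all maps and of omega-continuous maps\<close>

lemma function_lattice_pointwise_order:
  fixes Q (structure)
  assumes "complete_lattice Q"
  shows "function_lattice Q A (pointwise_order A Q)"
proof -
  interpret complete_lattice Q by fact
  show ?thesis
  proof unfold_locales
    fix S assume S: "S \<subseteq> carrier (pointwise_order A Q)"
    have "(\<lambda>f. f x) ` S \<subseteq> carrier Q" if "x \<in> A" for x
      using S that by (fastforce simp: pointwise_order_def)
    then show "(\<lambda>x\<in>A. \<Squnion>((\<lambda>f. f x) ` S)) \<in> carrier (pointwise_order A Q)"
      by (auto simp: pointwise_order_def)
  qed (auto simp: pointwise_order_def)
qed

text \<open>Interchange of suprema: the supremum over \<open>S\<close> commutes with the supremum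
  over a chain, so it yields an omega-continuous map again.\<close>

lemma function_lattice_omega_maps:
  fixes P :: "('a, 'n) gorder_scheme" and Q (structure)
  assumes "complete_lattice Q"
  shows "function_lattice Q (carrier P) (omega_maps P Q)"
proof -
  interpret complete_lattice Q by fact
  show ?thesis
  proof unfold_locales
    fix S assume S: "S \<subseteq> carrier (omega_maps P Q)"
    define G where "G = (\<lambda>x\<in>carrier P. \<Squnion>((\<lambda>f. f x) ` S))"
    have vals: "(\<lambda>f. f x) ` S \<subseteq> carrier Q" if "x \<in> carrier P" for x
      using S that by (fastforce simp: omega_maps_def)
    have G: "G \<in> carrier P \<rightarrow>\<^sub>E carrier Q"
      using vals by (auto simp: G_def)
    have above: "f x \<sqsubseteq> G x" if "f \<in> S" "x \<in> carrier P" for f x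
      using sup_upper[OF vals] that by (auto simp: G_def)
    have least: "G x \<sqsubseteq> y"
      if "x \<in> carrier P" "y \<in> carrier Q" "\<And>f. f \<in> S \<Longrightarrow> f x \<sqsubseteq> y" for x y
      unfolding G_def using that by (auto intro!: sup_least vals)
    have "is_lub Q (G u) (range (\<lambda>n. G (c n)))"
      if c: "omega_chain P c" and u: "is_lub P u (range c)" for c u
    proof -
      have uP: "u \<in> carrier P" and cP: "\<And>n. c n \<in> carrier P"
        using c u by (auto simp: omega_chain_def)
      have lub: "is_lub Q (f u) (range (\<lambda>n. f (c n)))" if "f \<in> S" for f
        using S c u that by (auto simp: omega_maps_def omega_continuous_def)
      have fc: "f (c n) \<in> carrier Q" if "f \<in> S" for f n
        using vals[OF cP] that by blast
      have fu: "f u \<in> carrier Q" if "f \<in> S" for f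
        using vals[OF uP] that by blast
      have GQ: "G u \<in> carrier Q" "G (c n) \<in> carrier Q" for n
        using G uP cP by auto
      have up: "f (c n) \<sqsubseteq> f u" if "f \<in> S" for f n
        using lub[OF that] fc[OF that] by (subst (asm) is_lub_iff) auto
      have "G (c n) \<sqsubseteq> G u" for n
        using up above uP fc fu GQ by (intro least[OF cP]) (blast intro: le_trans)+
      moreover have "G u \<sqsubseteq> y" if y: "y \<in> carrier Q" "\<And>n. G (c n) \<sqsubseteq> y" for y
      proof (rule least[OF uP \<open>y \<in> carrier Q\<close>])
        fix f assume f: "f \<in> S"
        \<comment> \<open>A bound \<open>y\<close> of all \<open>G (c n)\<close> bounds every
          \<open>f (c n)\<close>, hence \<open>f u\<close> by continuity of \<open>f\<close>, hence
          \<open>G u\<close> by leastness.\<close>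
        have "f (c n) \<sqsubseteq> y" for n
          using above[OF f cP] y fc[OF f] GQ by (blast intro: le_trans)
        then show "f u \<sqsubseteq> y"
          using lub[OF f] fc[OF f] y(1) by (subst (asm) is_lub_iff) auto
      qed
      ultimately show ?thesis
        using GQ by (subst is_lub_iff) auto
    qed
    then have "omega_continuous P Q G"
      by (auto simp: omega_continuous_def)
    then show "(\<lambda>x\<in>carrier P. \<Squnion>((\<lambda>f. f x) ` S)) \<in> carrier (omega_maps P Q)"
      using G by (simp add: omega_maps_def G_def)
  qed (auto simp: omega_maps_def)
qed

lemma complete_lattice_unit_interval: "complete_lattice unit_interval"
proof (rule complete_lattice_lubI)
  show "partial_order unit_interval"
    by (rule partial_orderI) (auto simp: unit_interval_def)
  fix S assume S: "S \<subseteq> carrier unit_interval"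
  \<comment> \<open>Inserting 0 covers the empty supremum, for which \<^const>\<open>Sup\<close> on the reals is unspecified.\<close>
  let ?s = "Sup (insert 0 S)"
  have bdd: "bdd_above (insert 0 S)"
    using S by (intro bdd_aboveI[of _ 1]) (auto simp: unit_interval_def)
  have "0 \<le> ?s" "\<forall>x\<in>S. x \<le> ?s"
    using bdd by (auto intro: cSup_upper)
  moreover have least: "?s \<le> y" if "0 \<le> y" "\<forall>x\<in>S. x \<le> y" for y
    using that by (intro cSup_least) auto
  moreover have "?s \<le> 1"
    using S by (intro least) (auto simp: unit_interval_def)
  ultimately have "is_lub unit_interval ?s S"
    using S by (subst is_lub_iff) (auto simp: unit_interval_def)
  then show "\<exists>u. is_lub unit_interval u S" ..
qed


section \<open>Chains and their suprema\<close>

text \<open>Chain condition and supremum are bundled so that a continuous map sends a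
  \<open>chain_lub\<close> to a \<open>chain_lub\<close>, and continuity facts compose.\<close>

definition chain_lub :: "('a, 'm) gorder_scheme \<Rightarrow> (nat \<Rightarrow> 'a) \<Rightarrow> 'a \<Rightarrow> bool" where
  "chain_lub P c u \<longleftrightarrow> omega_chain P c \<and> is_lub P u (range c)"

text \<open>Serves composites in which the value on infinite words stays fixed while the morphism
  varies along a chain.\<close>

lemma chain_lub_const:
  assumes "partial_order P" "x \<in> carrier P"
  shows "chain_lub P (\<lambda>_. x) x"
proof -
  interpret partial_order P by fact
  show ?thesis
    using assms(2) by (auto simp: chain_lub_def omega_chain_def is_lub_iff)
qed

lemma omega_continuous_mono:
  assumes "partial_order P" "omega_continuous P Q F" "F \<in> carrier P \<rightarrow> carrier Q"
    and le: "x \<sqsubseteq>\<^bsub>P\<^esub> y" "x \<in> carrier P" "y \<in> carrier P"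
  shows "F x \<sqsubseteq>\<^bsub>Q\<^esub> F y"
proof -
  interpret partial_order P by fact
  \<comment> \<open>The sequence x, y, y, ... is a chain with supremum \<open>y\<close>;
    preservation of this supremum puts \<open>F x\<close> below \<open>F y\<close>.\<close>
  define c where "c = (\<lambda>n::nat. if n = 0 then x else y)"
  have "omega_chain P c"
    using le by (auto simp: omega_chain_def c_def)
  moreover have "is_lub P y (range c)"
    using le by (subst is_lub_iff) (auto simp: c_def split: if_splits)
  ultimately have "is_lub Q (F y) (range (\<lambda>n. F (c n)))"
    using assms(2) by (auto simp: omega_continuous_def)
  moreover have "range (\<lambda>n. F (c n)) \<subseteq> carrier Q"
    using assms(3) le by (auto simp: c_def)
  ultimately have "F (c 0) \<sqsubseteq>\<^bsub>Q\<^esub> F y"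
    by (simp add: is_lub_iff)
  then show ?thesis
    by (simp add: c_def)
qed

text \<open>Continuity speaks of the supremum of the image; that the image is again a chain comes
  from monotonicity.\<close>

lemma omega_continuous_chain_lub:
  assumes "partial_order P" "omega_continuous P Q F" "F \<in> carrier P \<rightarrow> carrier Q"
    and "chain_lub P c u"
  shows "chain_lub Q (\<lambda>n. F (c n)) (F u)"
  using assms omega_continuous_mono[OF assms(1-3)]
  by (auto simp: chain_lub_def omega_chain_def omega_continuous_def)

text \<open>Membership in \<open>carrier L\<close> is listed separately, since the values on
  \<open>A\<close> alone do not imply it.\<close>

lemma (in function_lattice) chain_lub_pointwise:
  "chain_lub L c u \<longleftrightarrow>
     range c \<subseteq> carrier L \<and> u \<in> carrier L \<and> (\<forall>x\<in>A. chain_lub Q (\<lambda>n. c n x) (u x))"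
proof (cases "range c \<subseteq> carrier L")
  case True
  moreover have "range (\<lambda>n. c n x) = (\<lambda>f. f x) ` range c" for x
    by auto
  ultimately show ?thesis
    by (auto simp: chain_lub_def omega_chain_def is_lub_pointwise le_L value_closed range_subsetD)
qed (auto simp: chain_lub_def omega_chain_def)


section \<open>Observations\<close>

text \<open>Keeps \<open>\<sigma> \<in> lists \<Sigma>\<close> as one atom, the form in which the
  rules on words below state their premises.\<close>

declare in_lists_conv_set [simp del] in_listsD [rule del] in_listsI [rule del]

abbreviation obs_order ::
  "'s set \<Rightarrow> 'a set \<Rightarrow> ('s list \<times> 'a + 's stream \<Rightarrow> real) gorder" where
  "obs_order \<Sigma> Y \<equiv> pointwise_order (words \<Sigma> Y) unit_interval"

lemma carrier_unit_interval [simp]: "carrier unit_interval = {0..1}"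
  and le_unit_interval [simp]: "x \<sqsubseteq>\<^bsub>unit_interval\<^esub> y \<longleftrightarrow> x \<le> y"
  by (simp_all add: unit_interval_def)

lemma carrier_obs_order [simp]: "carrier (obs_order \<Sigma> Y) = observations \<Sigma> Y"
  by (simp add: pointwise_order_def observations_def)

lemma le_obs_order: "d \<sqsubseteq>\<^bsub>obs_order \<Sigma> Y\<^esub> e \<longleftrightarrow> (\<forall>w\<in>words \<Sigma> Y. d w \<le> e w)"
  by (simp add: pointwise_order_def)

interpretation obs: function_lattice unit_interval "words \<Sigma> Y" "obs_order \<Sigma> Y"
  for \<Sigma> :: "'s set" and Y :: "'a set"
  by (rule function_lattice_pointwise_order[OF complete_lattice_unit_interval])

interpretation DW: function_lattice unit_interval "observations \<Sigma> Y" "DD (words \<Sigma> Y)"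
  for \<Sigma> :: "'s set" and Y :: "'a set"
  using function_lattice_omega_maps[OF complete_lattice_unit_interval, of "obs_order \<Sigma> Y"]
  by (simp add: DD_def)

section \<open>Omega-continuous functionals on observations\<close>

lemma DD_iff:
  "F \<in> carrier (DD (words \<Sigma> Y)) \<longleftrightarrow>
     F \<in> observations \<Sigma> Y \<rightarrow>\<^sub>E {0..1} \<and>
     (\<forall>c u. chain_lub (obs_order \<Sigma> Y) c u \<longrightarrow> is_lub unit_interval (F u) (range (\<lambda>n. F (c n))))"
  by (simp add: DD_def omega_maps_def omega_continuous_def chain_lub_def)

lemma DD_range: "F \<in> carrier (DD (words \<Sigma> Y)) \<Longrightarrow> d \<in> observations \<Sigma> Y \<Longrightarrow> F d \<in> {0..1}"
  using DW.value_closed by simp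

lemma DD_chain_lub:
  assumes "F \<in> carrier (DD (words \<Sigma> Y))" "chain_lub (obs_order \<Sigma> Y) c u"
  shows "chain_lub unit_interval (\<lambda>n. F (c n)) (F u)"
  using assms
  by (intro omega_continuous_chain_lub[OF obs.partial_order _ _ assms(2)])
    (auto simp: DD_def omega_maps_def)

lemma DD_mono:
  assumes "F \<in> carrier (DD (words \<Sigma> Y))" "\<And>w. w \<in> words \<Sigma> Y \<Longrightarrow> d w \<le> e w"
    and "d \<in> observations \<Sigma> Y" "e \<in> observations \<Sigma> Y"
  shows "F d \<le> F e"
  using assms omega_continuous_mono[OF obs.partial_order, of \<Sigma> Y unit_interval F d e]
  by (auto simp: DD_def omega_maps_def le_obs_order)

section \<open>Finite and infinite words, and residuals of observations\<close>

lemma Inl_words [simp]: "Inl (\<sigma>, y) \<in> words \<Sigma> Y \<longleftrightarrow> \<sigma> \<in> lists \<Sigma> \<and> y \<in> Y"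
  and Inr_words [simp]: "Inr v \<in> words \<Sigma> Y \<longleftrightarrow> v \<in> streams \<Sigma>"
  by (auto simp: words_def)

lemma words_cases:
  assumes "w \<in> words \<Sigma> Y"
  obtains \<sigma> y where "w = Inl (\<sigma>, y)" "\<sigma> \<in> lists \<Sigma>" "y \<in> Y" | v where "w = Inr v" "v \<in> streams \<Sigma>"
  using assms by (auto simp: words_def)

lemma observations_eqI:
  assumes "d \<in> observations \<Sigma> Y" "e \<in> observations \<Sigma> Y"
    and "\<And>\<sigma> y. \<sigma> \<in> lists \<Sigma> \<Longrightarrow> y \<in> Y \<Longrightarrow> d (Inl (\<sigma>, y)) = e (Inl (\<sigma>, y))"
    and "\<And>v. v \<in> streams \<Sigma> \<Longrightarrow> d (Inr v) = e (Inr v)"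
  shows "d = e"
  using assms(1,2) unfolding observations_def
  by (rule PiE_ext) (auto elim!: words_cases simp: assms(3,4))

lemma residual_apply [simp]:
  "\<tau> \<in> lists \<Sigma> \<Longrightarrow> z \<in> Z \<Longrightarrow> residual \<Sigma> Z d \<sigma> (Inl (\<tau>, z)) = d (Inl (\<sigma> @ \<tau>, z))"
  "v \<in> streams \<Sigma> \<Longrightarrow> residual \<Sigma> Z d \<sigma> (Inr v) = d (Inr (\<sigma> @- v))"
  by (simp_all add: residual_def)

lemma observations_range: "d \<in> observations \<Sigma> Y \<Longrightarrow> w \<in> words \<Sigma> Y \<Longrightarrow> d w \<in> {0..1}"
  by (auto simp: observations_def)

lemma observationsI:
  assumes "d \<in> extensional (words \<Sigma> Y)"
    and "\<And>\<sigma> y. \<sigma> \<in> lists \<Sigma> \<Longrightarrow> y \<in> Y \<Longrightarrow> d (Inl (\<sigma>, y)) \<in> {0..1}"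
    and "\<And>v. v \<in> streams \<Sigma> \<Longrightarrow> d (Inr v) \<in> {0..1}"
  shows "d \<in> observations \<Sigma> Y"
  unfolding observations_def using assms by (auto simp: PiE_iff elim!: words_cases)

lemma residual_closed [simp]:
  assumes "d \<in> observations \<Sigma> Z" "\<sigma> \<in> lists \<Sigma>"
  shows "residual \<Sigma> Z d \<sigma> \<in> observations \<Sigma> Z"
proof (rule observationsI)
  show "residual \<Sigma> Z d \<sigma> \<in> extensional (words \<Sigma> Z)"
    by (simp add: residual_def)
qed (use assms observations_range[OF assms(1)] in \<open>auto simp: shift_streams\<close>)

lemma residual_Nil [simp]:
  assumes "d \<in> observations \<Sigma> Z"
  shows "residual \<Sigma> Z d [] = d"
  using assms by (intro observations_eqI) auto

text \<open>Associativity of concatenation: the prefix \<open>\<sigma>\<close> removed first becomes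
  the left factor.\<close>

lemma residual_residual:
  assumes "d \<in> observations \<Sigma> Z" "\<sigma> \<in> lists \<Sigma>" "\<tau> \<in> lists \<Sigma>"
  shows "residual \<Sigma> Z (residual \<Sigma> Z d \<sigma>) \<tau> = residual \<Sigma> Z d (\<sigma> @ \<tau>)"
  using assms by (intro observations_eqI[of _ \<Sigma> Z]) (auto simp: shift_streams)

text \<open>The value of a residual at a word is the value of the observation at that word prefixed
  by \<open>\<sigma>\<close>, so the pointwise suprema needed are among those of the original
  chain.\<close>

lemma residual_chain_lub:
  assumes "chain_lub (obs_order \<Sigma> Z) c u" "\<sigma> \<in> lists \<Sigma>"
  shows "chain_lub (obs_order \<Sigma> Z) (\<lambda>n. residual \<Sigma> Z (c n) \<sigma>) (residual \<Sigma> Z u \<sigma>)"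
proof -
  have c: "\<And>n. c n \<in> observations \<Sigma> Z" and u: "u \<in> observations \<Sigma> Z"
    and lub: "\<And>w. w \<in> words \<Sigma> Z \<Longrightarrow> chain_lub unit_interval (\<lambda>n. c n w) (u w)"
    using assms(1) by (auto simp: obs.chain_lub_pointwise range_subsetD)
  have "chain_lub unit_interval (\<lambda>n. residual \<Sigma> Z (c n) \<sigma> w) (residual \<Sigma> Z u \<sigma> w)"
    if "w \<in> words \<Sigma> Z" for w
    using that by (cases rule: words_cases) (use assms(2) in \<open>auto intro!: lub simp: shift_streams\<close>)
  then show ?thesis
    using c u assms(2) by (auto simp: obs.chain_lub_pointwise)
qed


section \<open>Composition\<close>

text \<open>The observation that \<open>DW_ext\<close> hands to its functional. Naming it turns the
  laws of composition into equations between observations.\<close>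

definition plug ::
  "'s set \<Rightarrow> 'a set \<Rightarrow> 'a set \<Rightarrow> ('a \<Rightarrow> ('s, 'a) functional) \<Rightarrow>
   ('s list \<times> 'a + 's stream \<Rightarrow> real) \<Rightarrow> ('s list \<times> 'a + 's stream \<Rightarrow> real)" where
  "plug \<Sigma> Y Z g d =
     (\<lambda>w\<in>words \<Sigma> Y. case w of Inl (\<sigma>, y) \<Rightarrow> g y (residual \<Sigma> Z d \<sigma>) | Inr v \<Rightarrow> d (Inr v))"

lemma plug_apply [simp]:
  "\<sigma> \<in> lists \<Sigma> \<Longrightarrow> y \<in> Y \<Longrightarrow> plug \<Sigma> Y Z g d (Inl (\<sigma>, y)) = g y (residual \<Sigma> Z d \<sigma>)"
  "v \<in> streams \<Sigma> \<Longrightarrow> plug \<Sigma> Y Z g d (Inr v) = d (Inr v)"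
  by (simp_all add: plug_def)

abbreviation hom :: "'s set \<Rightarrow> 'a set \<Rightarrow> 'a set \<Rightarrow> ('a \<Rightarrow> ('s, 'a) functional) set" where
  "hom \<Sigma> X Y \<equiv> X \<rightarrow>\<^sub>E carrier (DD (words \<Sigma> Y))"

text \<open>\<open>DW_le\<close> is the pointwise order applied twice, over \<open>X\<close> and
  over observations. Hom-sets thus become function lattices with values in the lattice
  \<open>DD (words \<Sigma> Y)\<close>.\<close>

lemma khom_KlDW: "khom (KlDW \<Sigma>) X Y = pointwise_order X (DD (words \<Sigma> Y))"
  by (simp add: khom_def KlDW_def pointwise_order_def DW.le_L DW_le_def[abs_def])

lemma carrier_khom [simp]: "carrier (khom (KlDW \<Sigma>) X Y) = hom \<Sigma> X Y"
  by (simp add: khom_KlDW pointwise_order_def)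

lemma le_khom:
  "f \<sqsubseteq>\<^bsub>khom (KlDW \<Sigma>) X Y\<^esub> g \<longleftrightarrow> (\<forall>x\<in>X. \<forall>d\<in>observations \<Sigma> Y. f x d \<le> g x d)"
  by (simp add: khom_def KlDW_def DW_le_def)

interpretation khom: function_lattice "DD (words \<Sigma> Y)" X "khom (KlDW \<Sigma>) X Y"
  for \<Sigma> :: "'s set" and X Y :: "'a set"
  unfolding khom_KlDW by (rule function_lattice_pointwise_order[OF DW.complete_lattice])

lemma hom_range: "f \<in> hom \<Sigma> X Y \<Longrightarrow> x \<in> X \<Longrightarrow> d \<in> observations \<Sigma> Y \<Longrightarrow> f x d \<in> {0..1}"
  using DD_range by blast

lemma hom_eqI:
  assumes "f \<in> hom \<Sigma> X Y" "g \<in> hom \<Sigma> X Y"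
    and "\<And>x d. x \<in> X \<Longrightarrow> d \<in> observations \<Sigma> Y \<Longrightarrow> f x d = g x d"
  shows "f = g"
  using assms(1,2)
proof (rule PiE_ext)
  fix x assume x: "x \<in> X"
  have "f x \<in> observations \<Sigma> Y \<rightarrow>\<^sub>E {0..1}" "g x \<in> observations \<Sigma> Y \<rightarrow>\<^sub>E {0..1}"
    using assms(1,2) x DD_iff by blast+
  then show "f x = g x"
    using assms(3)[OF x] by (rule PiE_ext)
qed

lemma plug_closed [simp]:
  assumes "g \<in> hom \<Sigma> Y Z" "d \<in> observations \<Sigma> Z"
  shows "plug \<Sigma> Y Z g d \<in> observations \<Sigma> Y"
proof (rule observationsI)
  show "plug \<Sigma> Y Z g d \<in> extensional (words \<Sigma> Y)"
    by (simp add: plug_def)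
  show "plug \<Sigma> Y Z g d (Inl (\<sigma>, y)) \<in> {0..1}" if "\<sigma> \<in> lists \<Sigma>" "y \<in> Y" for \<sigma> y
    unfolding plug_apply(1)[OF that] using that assms by (intro hom_range[where f = g and X = Y]) auto
  show "plug \<Sigma> Y Z g d (Inr v) \<in> {0..1}" if "v \<in> streams \<Sigma>" for v
    unfolding plug_apply(2)[OF that] using that assms(2) by (intro observations_range) auto
qed

text \<open>Morphism and observation may both vary, so one statement serves chains of observations
  with the morphism fixed and chains of morphisms with the observation fixed.\<close>

lemma plug_chain_lub:
  assumes "\<And>n. g n \<in> hom \<Sigma> Y Z" "h \<in> hom \<Sigma> Y Z"
    and "\<And>n. d n \<in> observations \<Sigma> Z" "e \<in> observations \<Sigma> Z"
    and fin: "\<And>\<sigma> y. \<sigma> \<in> lists \<Sigma> \<Longrightarrow> y \<in> Y \<Longrightarrow>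
      chain_lub unit_interval (\<lambda>n. g n y (residual \<Sigma> Z (d n) \<sigma>)) (h y (residual \<Sigma> Z e \<sigma>))"
    and inf: "\<And>v. v \<in> streams \<Sigma> \<Longrightarrow> chain_lub unit_interval (\<lambda>n. d n (Inr v)) (e (Inr v))"
  shows "chain_lub (obs_order \<Sigma> Y) (\<lambda>n. plug \<Sigma> Y Z (g n) (d n)) (plug \<Sigma> Y Z h e)"
proof -
  have "chain_lub unit_interval (\<lambda>n. plug \<Sigma> Y Z (g n) (d n) w) (plug \<Sigma> Y Z h e w)"
    if "w \<in> words \<Sigma> Y" for w
    using that by (cases rule: words_cases) (auto simp: fin inf)
  then show ?thesis
    using assms(1-4) by (auto simp: obs.chain_lub_pointwise)
qed

text \<open>Each \<open>g y\<close> is continuous and residuals preserve suprema of chains; on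
  infinite words \<open>plug\<close> returns the value of the observation unchanged.\<close>

lemma plug_chain_lub_observation:
  assumes g: "g \<in> hom \<Sigma> Y Z" and d: "chain_lub (obs_order \<Sigma> Z) d e"
  shows "chain_lub (obs_order \<Sigma> Y) (\<lambda>n. plug \<Sigma> Y Z g (d n)) (plug \<Sigma> Y Z g e)"
proof (rule plug_chain_lub)
  show "d n \<in> observations \<Sigma> Z" "e \<in> observations \<Sigma> Z" for n
    using d by (auto simp: obs.chain_lub_pointwise range_subsetD)
  show "chain_lub unit_interval (\<lambda>n. g y (residual \<Sigma> Z (d n) \<sigma>)) (g y (residual \<Sigma> Z e \<sigma>))"
    if "\<sigma> \<in> lists \<Sigma>" "y \<in> Y" for \<sigma> y
    using g that residual_chain_lub[OF d] by (intro DD_chain_lub) auto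
  show "chain_lub unit_interval (\<lambda>n. d n (Inr v)) (e (Inr v))" if "v \<in> streams \<Sigma>" for v
    using d that by (auto simp: obs.chain_lub_pointwise)
qed (use g in auto)

section \<open>Composites, identities and the category laws\<close>

lemma kcomp_apply:
  assumes "x \<in> X" "d \<in> observations \<Sigma> Z"
  shows "kcomp (KlDW \<Sigma>) X Y Z g f x d = f x (plug \<Sigma> Y Z g d)"
  using assms by (simp add: kcomp_def KlDW_def DW_ext_def plug_def)

lemma kcomp_closed:
  assumes f: "f \<in> hom \<Sigma> X Y" and g: "g \<in> hom \<Sigma> Y Z"
  shows "kcomp (KlDW \<Sigma>) X Y Z g f \<in> hom \<Sigma> X Z"
proof (rule PiE_I)
  fix x assume x: "x \<in> X"
  then have fx: "f x \<in> carrier (DD (words \<Sigma> Y))"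
    using f by auto
  let ?h = "kcomp (KlDW \<Sigma>) X Y Z g f x"
  have "?h \<in> extensional (observations \<Sigma> Z)"
    using x by (simp add: kcomp_def KlDW_def DW_ext_def)
  moreover have "?h d \<in> {0..1}" if "d \<in> observations \<Sigma> Z" for d
    unfolding kcomp_apply[OF x that] using f g x that by (intro hom_range[where f = f and X = X and Y = Y]) auto
  moreover have "is_lub unit_interval (?h u) (range (\<lambda>n. ?h (c n)))"
    if cu: "chain_lub (obs_order \<Sigma> Z) c u" for c u
  proof -
    have "c n \<in> observations \<Sigma> Z" "u \<in> observations \<Sigma> Z" for n
      using cu by (auto simp: obs.chain_lub_pointwise range_subsetD)
    \<comment> \<open>Continuity of \<open>plug\<close> in the observation is followed by continuity
      of \<open>f x\<close>.\<close>
    then show ?thesis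
      using DD_chain_lub[OF fx plug_chain_lub_observation[OF g cu]]
      by (simp add: kcomp_apply[OF x] chain_lub_def)
  qed
  ultimately show "?h \<in> carrier (DD (words \<Sigma> Z))"
    unfolding DD_iff by (auto simp: PiE_iff)
qed (simp add: kcomp_def)

lemma DW_ident_apply:
  "x \<in> X \<Longrightarrow> d \<in> observations \<Sigma> X \<Longrightarrow> ident (KlDW \<Sigma>) X x d = d (Inl ([], x))"
  by (simp add: KlDW_def DW_ident_def)

lemma ident_closed: "ident (KlDW \<Sigma>) X \<in> hom \<Sigma> X X"
proof (rule PiE_I)
  fix x assume x: "x \<in> X"
  let ?i = "ident (KlDW \<Sigma>) X x"
  have "?i \<in> extensional (observations \<Sigma> X)"
    using x by (simp add: KlDW_def DW_ident_def)
  moreover have "?i d \<in> {0..1}" if "d \<in> observations \<Sigma> X" for d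
    unfolding DW_ident_apply[OF x that] using x that by (intro observations_range) auto
  moreover have "is_lub unit_interval (?i u) (range (\<lambda>n. ?i (c n)))"
    if cu: "chain_lub (obs_order \<Sigma> X) c u" for c u
  proof -
    have "c n \<in> observations \<Sigma> X" "u \<in> observations \<Sigma> X" for n
      using cu by (auto simp: obs.chain_lub_pointwise range_subsetD)
    \<comment> \<open>Evaluation at a single word is continuous because suprema of observations are
      pointwise.\<close>
    moreover have "chain_lub unit_interval (\<lambda>n. c n (Inl ([], x))) (u (Inl ([], x)))"
      using cu x by (simp add: obs.chain_lub_pointwise)
    ultimately show ?thesis
      using x by (simp add: DW_ident_apply chain_lub_def)
  qed
  ultimately show "?i \<in> carrier (DD (words \<Sigma> X))"
    unfolding DD_iff by (auto simp: PiE_iff)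
qed (simp add: KlDW_def DW_ident_def)

text \<open>With \<open>\<tau>\<close> the remaining finite word, both sides feed \<open>g\<close>
  the residual by \<open>\<sigma> @ \<tau>\<close>; on an infinite word \<open>v\<close> both read
  \<open>d\<close> at \<open>\<sigma> @- v\<close>.\<close>

lemma residual_plug:
  assumes "g \<in> hom \<Sigma> Y Z" "d \<in> observations \<Sigma> Z" "\<sigma> \<in> lists \<Sigma>"
  shows "residual \<Sigma> Y (plug \<Sigma> Y Z g d) \<sigma> = plug \<Sigma> Y Z g (residual \<Sigma> Z d \<sigma>)"
  using assms by (intro observations_eqI[of _ \<Sigma> Y]) (auto simp: shift_streams residual_residual)

text \<open>\<open>plug\<close> reverses composition, which is what associativity comes down to. On
  finite words the residual has to pass through \<open>plug \<Sigma> Y Z h\<close>, by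
  \<open>residual_plug\<close>.\<close>

lemma plug_kcomp:
  assumes "g \<in> hom \<Sigma> X Y" "h \<in> hom \<Sigma> Y Z" "d \<in> observations \<Sigma> Z"
  shows "plug \<Sigma> X Z (kcomp (KlDW \<Sigma>) X Y Z h g) d = plug \<Sigma> X Y g (plug \<Sigma> Y Z h d)"
  using assms kcomp_closed[OF assms(1,2)]
  by (intro observations_eqI[of _ \<Sigma> X]) (auto simp: kcomp_apply residual_plug)

text \<open>The identity reads the residual by \<open>\<sigma>\<close> at the empty word, which is
  \<open>d\<close> at \<open>\<sigma> @ []\<close>.\<close>

lemma plug_ident:
  assumes "d \<in> observations \<Sigma> X"
  shows "plug \<Sigma> X X (ident (KlDW \<Sigma>) X) d = d"
  using assms ident_closed[of \<Sigma> X]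
  by (intro observations_eqI) (auto simp: DW_ident_apply)

lemma kleisli_category_KlDW: "kleisli_category (KlDW \<Sigma>)"
  unfolding kleisli_category_def carrier_khom
proof (intro conjI allI ballI)
  show "ident (KlDW \<Sigma>) X \<in> hom \<Sigma> X X" for X
    by (rule ident_closed)
  show "kcomp (KlDW \<Sigma>) X Y Z g f \<in> hom \<Sigma> X Z" if "f \<in> hom \<Sigma> X Y" "g \<in> hom \<Sigma> Y Z" for X Y Z f g
    using that by (rule kcomp_closed)
  fix X Y f assume f: "f \<in> hom \<Sigma> X Y"
  \<comment> \<open>The identity evaluates the plugged observation at the empty word, where the
    residual by \<open>[]\<close> is \<open>d\<close> itself.\<close>
  show "kcomp (KlDW \<Sigma>) X X Y f (ident (KlDW \<Sigma>) X) = f"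
    using f kcomp_closed[OF ident_closed f]
    by (intro hom_eqI) (auto simp: kcomp_apply DW_ident_apply)
  show "kcomp (KlDW \<Sigma>) X Y Y (ident (KlDW \<Sigma>) Y) f = f"
    using f kcomp_closed[OF f ident_closed]
    by (intro hom_eqI) (auto simp: kcomp_apply plug_ident)
next
  fix W X Y Z f g h
  assume f: "f \<in> hom \<Sigma> W X" and g: "g \<in> hom \<Sigma> X Y" and h: "h \<in> hom \<Sigma> Y Z"
  \<comment> \<open>By \<open>plug_kcomp\<close> both sides evaluate \<open>f\<close> at the same
    observation.\<close>
  show "kcomp (KlDW \<Sigma>) W X Z (kcomp (KlDW \<Sigma>) X Y Z h g) f =
        kcomp (KlDW \<Sigma>) W Y Z h (kcomp (KlDW \<Sigma>) W X Y g f)"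
    by (rule hom_eqI[OF kcomp_closed[OF f kcomp_closed[OF g h]] kcomp_closed[OF kcomp_closed[OF f g] h]])
      (use g h in \<open>simp add: kcomp_apply plug_kcomp\<close>)
qed


section \<open>Suprema of morphisms\<close>

lemma kcomp_mono:
  assumes "f \<in> hom \<Sigma> X Y" "f' \<in> hom \<Sigma> X Y" "g \<in> hom \<Sigma> Y Z" "g' \<in> hom \<Sigma> Y Z"
    and f: "f \<sqsubseteq>\<^bsub>khom (KlDW \<Sigma>) X Y\<^esub> f'" and g: "g \<sqsubseteq>\<^bsub>khom (KlDW \<Sigma>) Y Z\<^esub> g'"
  shows "kcomp (KlDW \<Sigma>) X Y Z g f \<sqsubseteq>\<^bsub>khom (KlDW \<Sigma>) X Z\<^esub> kcomp (KlDW \<Sigma>) X Y Z g' f'"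
  unfolding le_khom
proof (intro ballI)
  fix x d assume x: "x \<in> X" and d: "d \<in> observations \<Sigma> Z"
  have "plug \<Sigma> Y Z g d w \<le> plug \<Sigma> Y Z g' d w" if "w \<in> words \<Sigma> Y" for w
    using that g d by (cases rule: words_cases) (auto simp: le_khom)
  \<comment> \<open>The first inequality varies the observation and rests on monotonicity of
    \<open>f x\<close>, a consequence of its continuity; the second compares \<open>f\<close> with
    \<open>f'\<close> at one observation.\<close>
  then have "f x (plug \<Sigma> Y Z g d) \<le> f x (plug \<Sigma> Y Z g' d)"
    using assms(1,3,4) x d by (intro DD_mono[of "f x" \<Sigma> Y]) auto
  also have "\<dots> \<le> f' x (plug \<Sigma> Y Z g' d)"
    using f x d assms(4) by (auto simp: le_khom)
  finally show "kcomp (KlDW \<Sigma>) X Y Z g f x d \<le> kcomp (KlDW \<Sigma>) X Y Z g' f' x d"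
    using x d by (simp add: kcomp_apply)
qed

text \<open>The pointwise description is applied twice, over \<open>X\<close> and over observations,
  which reduces suprema of morphisms to suprema of reals.\<close>

lemma is_lub_khom:
  assumes "S \<subseteq> hom \<Sigma> X Y"
  shows "is_lub (khom (KlDW \<Sigma>) X Y) u S \<longleftrightarrow> u \<in> hom \<Sigma> X Y \<and>
     (\<forall>x\<in>X. \<forall>d\<in>observations \<Sigma> Y. is_lub unit_interval (u x d) ((\<lambda>f. f x d) ` S))"
proof -
  have "(\<lambda>f. f x) ` S \<subseteq> carrier (DD (words \<Sigma> Y))" if "x \<in> X" for x
    using assms that by blast
  then show ?thesis
    using assms by (auto simp: khom.is_lub_pointwise DW.is_lub_pointwise image_image)
qed

text \<open>For fixed \<open>d\<close>, every functional is evaluated at the same observation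
  \<open>plug \<Sigma> Y Z g d\<close>, and suprema are tested at each observation separately.
  \<open>S\<close> is arbitrary, so chains and finite sets, the empty one included, are covered at
  once.\<close>

lemma kcomp_is_lub_left:
  assumes g: "g \<in> hom \<Sigma> Y Z" and S: "S \<subseteq> hom \<Sigma> X Y"
    and u: "is_lub (khom (KlDW \<Sigma>) X Y) u S"
  shows "is_lub (khom (KlDW \<Sigma>) X Z) (kcomp (KlDW \<Sigma>) X Y Z g u) (kcomp (KlDW \<Sigma>) X Y Z g ` S)"
proof -
  have u_hom: "u \<in> hom \<Sigma> X Y"
    and lub: "\<forall>x\<in>X. \<forall>d\<in>observations \<Sigma> Y. is_lub unit_interval (u x d) ((\<lambda>f. f x d) ` S)"
    using u unfolding is_lub_khom[OF S] by auto
  have im: "kcomp (KlDW \<Sigma>) X Y Z g ` S \<subseteq> hom \<Sigma> X Z"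
    using S g by (intro image_subsetI kcomp_closed) auto
  show ?thesis
    unfolding is_lub_khom[OF im]
    using kcomp_closed[OF u_hom g] lub g by (simp add: kcomp_apply image_image)
qed

text \<open>Varying the outer morphism changes the observation fed to \<open>f x\<close>. What
  \<open>f x\<close> is known to preserve are suprema of chains, hence the restriction to
  chains.\<close>

lemma kcomp_is_lub_right:
  assumes f: "f \<in> hom \<Sigma> X Y" and c: "chain_lub (khom (KlDW \<Sigma>) Y Z) c u"
  shows "is_lub (khom (KlDW \<Sigma>) X Z) (kcomp (KlDW \<Sigma>) X Y Z u f)
           (range (\<lambda>n. kcomp (KlDW \<Sigma>) X Y Z (c n) f))"
proof -
  have cn: "\<And>n. c n \<in> hom \<Sigma> Y Z" and u: "u \<in> hom \<Sigma> Y Z"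
    and lub: "\<And>y d. y \<in> Y \<Longrightarrow> d \<in> observations \<Sigma> Z \<Longrightarrow>
      chain_lub unit_interval (\<lambda>n. c n y d) (u y d)"
    using c by (auto simp: khom.chain_lub_pointwise DW.chain_lub_pointwise range_subsetD)
  have "is_lub unit_interval (f x (plug \<Sigma> Y Z u d)) (range (\<lambda>n. f x (plug \<Sigma> Y Z (c n) d)))"
    if x: "x \<in> X" and d: "d \<in> observations \<Sigma> Z" for x d
  proof -
    \<comment> \<open>On finite words the plugged values follow the chain \<open>c\<close>; on
      infinite words they are constant.\<close>
    have "chain_lub (obs_order \<Sigma> Y) (\<lambda>n. plug \<Sigma> Y Z (c n) d) (plug \<Sigma> Y Z u d)"
    proof (rule plug_chain_lub)
      show "chain_lub unit_interval (\<lambda>_. d (Inr v)) (d (Inr v))" if "v \<in> streams \<Sigma>" for v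
        using observations_range[OF d] that
        by (intro chain_lub_const complete_lattice.axioms(1)[OF complete_lattice_unit_interval]) auto
    qed (use cn u lub d in auto)
    moreover have "f x \<in> carrier (DD (words \<Sigma> Y))"
      using f x by auto
    ultimately show ?thesis
      using DD_chain_lub unfolding chain_lub_def by blast
  qed
  moreover have "range (\<lambda>n. kcomp (KlDW \<Sigma>) X Y Z (c n) f) \<subseteq> hom \<Sigma> X Z"
    using kcomp_closed[OF f cn] by blast
  ultimately show ?thesis
    using kcomp_closed[OF f u] by (simp add: is_lub_khom kcomp_apply image_image)
qed

theorem theorem6p4:
  fixes \<Sigma> :: "'s set"
  shows "let C = (KlDW \<Sigma> :: ('a, ('s, 'a) functional) kleisli) in
           (order_enriched C \<and> pointwise_induced C) \<and>
           omega_Cpo_enriched C \<and>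
           left_distributive C \<and>
           (\<forall>X Y. complete_lattice (khom C X Y))"
proof -
  let ?C = "KlDW \<Sigma> :: ('a, ('s, 'a) functional) kleisli"
  have enriched: "order_enriched ?C"
    unfolding order_enriched_def carrier_khom
    by (intro conjI allI ballI impI kleisli_category_KlDW khom.partial_order kcomp_mono) auto
  have Mon: "Mon ?C Y = DD (words \<Sigma> Y)" for Y
    by (simp add: KlDW_def)
  have induced: "pointwise_induced ?C"
    by (simp add: pointwise_induced_def Mon DW.partial_order khom.le_L)
  \<comment> \<open>Stated for arbitrary sets, this supplies the suprema of chains as well as the
    finite ones.\<close>
  have lub: "\<exists>u. is_lub (khom ?C X Y) u S" if "S \<subseteq> hom \<Sigma> X Y" for X Y S
    by (rule exI, rule khom.is_lub_sup) (simp add: that)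
  have chain: "range c \<subseteq> hom \<Sigma> X Y" if "omega_chain (khom ?C X Y) c" for X Y c
    using that by (auto simp: omega_chain_def)
  have left: "is_lub (khom ?C X Z) (kcomp ?C X Y Z g u) (range (\<lambda>n. kcomp ?C X Y Z g (c n)))"
    if "g \<in> hom \<Sigma> Y Z" "omega_chain (khom ?C X Y) c" "is_lub (khom ?C X Y) u (range c)"
    for X Y Z c u g
    using kcomp_is_lub_left[OF that(1) chain[OF that(2)] that(3)] by (simp add: image_image)
  have "omega_Cpo_enriched ?C"
    unfolding omega_Cpo_enriched_def carrier_khom
    by (intro conjI allI ballI impI enriched lub[OF chain] left kcomp_is_lub_right)
      (auto simp: chain_lub_def)
  moreover have "left_distributive ?C"
    unfolding left_distributive_def carrier_khom
    by (intro conjI allI ballI impI lub kcomp_is_lub_left) auto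
  ultimately show ?thesis
    using enriched induced by (simp add: Let_def khom.complete_lattice)
qed

end
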